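(* Assume that for every $v_H\in V_H$ the constrained correction problem: find $v_f(v_H)\in V_f$ such that $$A(v_H+v_f(v_H);w_f)=L(w_f)\qquad\forall\,w_f\in V_f$$ is uniquely solvable, let $M_h(v_H)=v_H+v_f(v_H)$, and assume that $M_h:V_H\to V_h$ is differentiable at the coarse states considered below. (i) If $\widehat u_H\in V_H$ solves the ideal manifold equation $$A\bigl(M_h(\widehat u_H);DM_h(\widehat u_H)[\delta v_H]\bigr)=L\bigl(DM_h(\widehat u_H)[\delta v_H]\bigr)\qquad\forall\,\delta v_H\in V_H,$$ then $\widehat u_h=M_h(\widehat u_H)$ solves the fine-scale problem $$A(\widehat u_h;v_h)=L(v_h)\qquad\forall\,v_h\in V_h .$$ (ii) Conversely, if $u_h\in V_h$ solves the fine-scale problem $A(u_h;v_h)=L(v_h)$ for all $v_h\in V_h$, and $u_H=\Pi_Hu_h$, then $u_h=M_h(u_H)$ and $u_H$ solves the ideal manifold equation, i.e. $$A\bigl(M_h(u_H);DM_h(u_H)[\delta v_H]\bigr)=L\bigl(DM_h(u_H)[\delta v_H]\bigr)\qquad\forall\,\delta v_H\in V_H .$$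
   Context: Let $\Omega$ be a bounded polygonal or polyhedral domain with nested, shape-regular, quasi-uniform triangulations $\mathcal T_H$ (coarse) and $\mathcal T_h$ (fine, a refinement of $\mathcal T_H$). $V_H\subset V_h$ are the corresponding (finite-dimensional) spaces of continuous piecewise linear finite element functions with homogeneous Dirichlet boundary conditions, and $\|\cdot\|_V$ is the energy norm on $V_h$. $A(\cdot;\cdot):V_h\times V_h\to\mathbb R$ is nonlinear in its first and linear in its second argument, and $L:V_h\to\mathbb R$ is linear. $\Pi_H:V_h\to V_H$ is a linear projection onto $V_H$, i.e. $\Pi_Hv_H=v_H$ for all $v_H\in V_H$, stable in the sense $\|\Pi_Hv_h\|_V\le C_\Pi\|v_h\|_V$ for all $v_h\in V_h$. The fine-scale space is $V_f=\ker\Pi_H$. The fine-scale problem (find $u_h\in V_h$ with $A(u_h;v_h)=L(v_h)$ for all $v_h\in V_h$) is assumed throughout to be uniquely solvable. In (i) differentiability is required at $\widehat u_H$, in (ii) at $\Pi_Hu_h$. *)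

theory Defs
  imports "HOL-Analysis.Analysis"
begin

section \<open>Meshes\<close>

definition polyhedral_domain :: "'a::euclidean_space set \<Rightarrow> bool" where
  "polyhedral_domain \<Omega> \<longleftrightarrow>
     open \<Omega> \<and> connected \<Omega> \<and> \<Omega> \<noteq> {} \<and> bounded \<Omega> \<and>
     (\<exists>\<P>. finite \<P> \<and> (\<forall>P\<in>\<P>. polytope P \<and> aff_dim P = int DIM('a) - 1) \<and> frontier \<Omega> = \<Union>\<P>)"

text \<open>The predicate \<^const>\<open>triangulation\<close> allows simplices of any dimension and does not say
  what is covered. The last conjunct says that the mesh resolves the boundary, which matters only
  for domains lying on both sides of a part of their boundary (slits).\<close>

definition mesh_of :: "'a::euclidean_space set \<Rightarrow> 'a set set \<Rightarrow> bool" where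
  "mesh_of \<Omega> \<T> \<longleftrightarrow>
     triangulation \<T> \<and> (\<forall>T\<in>\<T>. int DIM('a) simplex T) \<and> \<Union>\<T> = closure \<Omega> \<and>
     frontier \<Omega> = \<Union>{F. (\<exists>T\<in>\<T>. F face_of T) \<and> F \<subseteq> frontier \<Omega>}"

definition mesh_refines :: "'a set set \<Rightarrow> 'a set set \<Rightarrow> bool" where
  "mesh_refines \<T>' \<T> \<longleftrightarrow> (\<forall>T'\<in>\<T>'. \<exists>T\<in>\<T>. T' \<subseteq> T)"

definition inradius :: "'a::euclidean_space set \<Rightarrow> real" where
  "inradius T = Sup {r. 0 \<le> r \<and> (\<exists>x. cball x r \<subseteq> T)}"

definition shape_regular :: "real \<Rightarrow> 'a::euclidean_space set set \<Rightarrow> bool" where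
  "shape_regular \<sigma> \<T> \<longleftrightarrow> (\<forall>T\<in>\<T>. diameter T \<le> \<sigma> * inradius T)"

definition quasi_uniform :: "real \<Rightarrow> 'a::euclidean_space set set \<Rightarrow> bool" where
  "quasi_uniform \<rho> \<T> \<longleftrightarrow> (\<forall>T\<in>\<T>. \<forall>T'\<in>\<T>. diameter T \<le> \<rho> * diameter T')"


section \<open>Finite element spaces and forms\<close>

text \<open>A continuous function on \<open>closure \<Omega>\<close> that vanishes on the boundary is identified with its
  continuous extension by zero. The finite element space is thereby a linear subspace of the normed
  space of bounded continuous functions on the whole Euclidean space.\<close>

definition P1_space :: "'a::euclidean_space set \<Rightarrow> 'a set set \<Rightarrow> ('a \<Rightarrow>\<^sub>C real) set" where
  "P1_space \<Omega> \<T> =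
     {v. (\<forall>x. x \<notin> \<Omega> \<longrightarrow> apply_bcontfun v x = 0) \<and>
         (\<forall>T\<in>\<T>. \<exists>a b. \<forall>x\<in>T. apply_bcontfun v x = a \<bullet> x + b)}"

definition linear_on_subspace ::
  "'v::real_vector set \<Rightarrow> ('v \<Rightarrow> 'w::real_vector) \<Rightarrow> bool" where
  "linear_on_subspace V f \<longleftrightarrow>
     (\<forall>x\<in>V. \<forall>y\<in>V. f (x + y) = f x + f y) \<and> (\<forall>c. \<forall>x\<in>V. f (c *\<^sub>R x) = c *\<^sub>R f x)"

definition inner_product_on :: "'v::real_vector set \<Rightarrow> ('v \<Rightarrow> 'v \<Rightarrow> real) \<Rightarrow> bool" where
  "inner_product_on V a \<longleftrightarrow>
     (\<forall>x\<in>V. linear_on_subspace V (a x)) \<and> (\<forall>x\<in>V. \<forall>y\<in>V. a x y = a y x) \<and>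
     (\<forall>x\<in>V. x \<noteq> 0 \<longrightarrow> a x x > 0)"

definition energy_norm :: "('v \<Rightarrow> 'v \<Rightarrow> real) \<Rightarrow> 'v \<Rightarrow> real" where
  "energy_norm a v = sqrt (a v v)"

definition stable_projection ::
  "('v::real_vector \<Rightarrow> real) \<Rightarrow> real \<Rightarrow> 'v set \<Rightarrow> 'v set \<Rightarrow> ('v \<Rightarrow> 'v) \<Rightarrow> bool" where
  "stable_projection nrm C Vh VH P \<longleftrightarrow>
     linear_on_subspace Vh P \<and> (\<forall>v\<in>Vh. P v \<in> VH) \<and> (\<forall>v\<in>VH. P v = v) \<and>
     (\<forall>v\<in>Vh. nrm (P v) \<le> C * nrm v)"

definition fine_space :: "'v set \<Rightarrow> ('v \<Rightarrow> 'v::zero) \<Rightarrow> 'v set" where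
  "fine_space Vh P = {v \<in> Vh. P v = 0}"


section \<open>The fine-scale, correction and manifold problems\<close>

definition solves_fine_scale ::
  "'v set \<Rightarrow> ('v \<Rightarrow> 'v \<Rightarrow> real) \<Rightarrow> ('v \<Rightarrow> real) \<Rightarrow> 'v \<Rightarrow> bool" where
  "solves_fine_scale Vh A L u \<longleftrightarrow> u \<in> Vh \<and> (\<forall>v\<in>Vh. A u v = L v)"

definition solves_correction ::
  "'v::plus set \<Rightarrow> ('v \<Rightarrow> 'v \<Rightarrow> real) \<Rightarrow> ('v \<Rightarrow> real) \<Rightarrow> 'v \<Rightarrow> 'v \<Rightarrow> bool" where
  "solves_correction Vf A L v vf \<longleftrightarrow> vf \<in> Vf \<and> (\<forall>w\<in>Vf. A (v + vf) w = L w)"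

definition corrector ::
  "'v::plus set \<Rightarrow> ('v \<Rightarrow> 'v \<Rightarrow> real) \<Rightarrow> ('v \<Rightarrow> real) \<Rightarrow> 'v \<Rightarrow> 'v" where
  "corrector Vf A L v = (THE vf. solves_correction Vf A L v vf)"

definition manifold_map ::
  "'v::plus set \<Rightarrow> ('v \<Rightarrow> 'v \<Rightarrow> real) \<Rightarrow> ('v \<Rightarrow> real) \<Rightarrow> 'v \<Rightarrow> 'v" where
  "manifold_map Vf A L v = v + corrector Vf A L v"

text \<open>Differentiability and the derivative of the manifold map are taken within the coarse space.
  Only the values of the derivative on the coarse space are used; there it is uniquely determined.
  The finite element spaces are finite dimensional, so it is immaterial that the ambient topology
  comes from the sup norm and not from the energy norm, and that the derivative is a bounded linear
  map on the ambient space: every linear map on the coarse space extends to one.\<close>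

definition solves_ideal_manifold ::
  "'v::real_normed_vector set \<Rightarrow> 'v set \<Rightarrow> ('v \<Rightarrow> 'v \<Rightarrow> real) \<Rightarrow> ('v \<Rightarrow> real) \<Rightarrow> 'v \<Rightarrow> bool" where
  "solves_ideal_manifold VH Vf A L u \<longleftrightarrow>
     (let M = manifold_map Vf A L; DM = frechet_derivative M (at u within VH)
      in u \<in> VH \<and> (\<forall>\<delta>\<in>VH. A (M u) (DM \<delta>) = L (DM \<delta>)))"

end

theory Submission
  imports Defs
begin

text \<open>Differentiating the identity \<open>P\<^sub>H (M\<^sub>h v) = v\<close> on the coarse space would give
  \<open>P\<^sub>H (DM\<^sub>h \<delta>) = \<delta>\<close>, so that the range of \<open>DM\<^sub>h\<close> complements the fine space \<open>V\<^sub>f\<close> in \<open>V\<^sub>h\<close>;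
  together with the correction equation, testing with this range is the same as testing with \<open>V\<^sub>h\<close>.
  No continuity of \<open>P\<^sub>H\<close> is needed: \<open>M\<^sub>h v - v\<close> takes values in \<open>V\<^sub>f\<close>, which is closed because
  finitely many point evaluations separate its elements, hence \<open>DM\<^sub>h \<delta> - \<delta> \<in> V\<^sub>f\<close>.\<close>

section \<open>Closed subspaces and derivatives along them\<close>

text \<open>Induction on the number of functionals. If \<open>k\<close> does not vanish on all of
  \<open>W\<close>, projecting along some \<open>w\<close> in \<open>W\<close> exhibits
  \<open>W\<close> as a continuous preimage of its intersection with the kernel of
  \<open>k\<close>.\<close>

lemma closed_subspace_if_separated:
  fixes W :: "'v::real_normed_vector set"
  assumes "finite K" "subspace W" "\<And>k. k \<in> K \<Longrightarrow> bounded_linear (k :: 'v \<Rightarrow> real)"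
    and "\<And>v. v \<in> W \<Longrightarrow> (\<And>k. k \<in> K \<Longrightarrow> k v = 0) \<Longrightarrow> v = 0"
  shows "closed W"
  using assms
proof (induction K arbitrary: W rule: finite_induct)
  case empty
  then have "W = {0}" using subspace_0 by auto
  then show ?case by simp
next
  case (insert k K)
  interpret k: bounded_linear k using insert.prems by blast
  let ?W = "W \<inter> {v. k v = 0}"
  have "subspace {v. k v = 0}"
    by (simp add: subspace_def k.add k.scaleR k.zero)
  then have sub: "subspace ?W" using insert.prems(1) subspace_inter by blast
  \<comment> \<open>On \<open>?W\<close> the functional \<open>k\<close> is zero anyway, so the
    functionals in \<open>K\<close> alone separate points there.\<close>
  have cl: "closed ?W"
    by (rule insert.IH[OF sub]) (use insert.prems in auto)
  show ?case
  proof (cases "W \<subseteq> {v. k v = 0}")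
    case True
    then show ?thesis using cl by (simp add: Int_absorb2)
  next
    case False
    then obtain w where w: "w \<in> W" "k w \<noteq> 0" by auto
    \<comment> \<open>This is the projection onto the kernel of \<open>k\<close> along
      \<open>w\<close>. It moves every point by a multiple of \<open>w\<close>, so
      \<open>?q x\<close> lies in \<open>W\<close> exactly when \<open>x\<close> does.\<close>
    let ?q = "\<lambda>x. x - (k x / k w) *\<^sub>R w"
    have "W = ?q -` ?W"
    proof (intro set_eqI iffI)
      fix x assume "x \<in> W"
      then have "?q x \<in> W"
        using w insert.prems(1) by (intro subspace_diff subspace_scale) auto
      then show "x \<in> ?q -` ?W" using w by (simp add: k.diff k.scaleR)
    next
      fix x assume "x \<in> ?q -` ?W"
      then have "?q x + (k x / k w) *\<^sub>R w \<in> W"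
        using w insert.prems(1) by (intro subspace_add subspace_scale) auto
      then show "x \<in> W" by simp
    qed
    moreover have "closed (?q -` ?W)"
      using cl by (intro continuous_closed_vimage) (auto intro!: continuous_intros k.continuous w)
    ultimately show ?thesis by simp
  qed
qed

text \<open>Difference quotients of \<open>f\<close> along the line through \<open>u\<close> in
  direction \<open>d\<close> stay in \<open>W\<close>, and closedness keeps their limit
  there.\<close>

lemma has_derivative_in_closed_subspace:
  fixes f :: "'v::real_normed_vector \<Rightarrow> 'w::real_normed_vector"
  assumes f: "(f has_derivative D) (at u within V)" and V: "subspace V" "u \<in> V" "d \<in> V"
    and W: "subspace W" "closed W" "\<And>v. v \<in> V \<Longrightarrow> f v \<in> W"
  shows "D d \<in> W"
proof -
  have in_V: "u + t *\<^sub>R d \<in> V" for t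
    using V by (intro subspace_add subspace_scale)
  \<comment> \<open>The line lies in \<open>V\<close>, so composing with it turns the derivative
    within \<open>V\<close> into an ordinary derivative in one real variable.\<close>
  have "((\<lambda>t. u + t *\<^sub>R d) has_derivative (\<lambda>t. t *\<^sub>R d)) (at 0)"
    by (auto intro!: derivative_eq_intros)
  moreover have "(f has_derivative D) (at (u + 0 *\<^sub>R d) within range (\<lambda>t. u + t *\<^sub>R d))"
    using has_derivative_subset[OF f] in_V by (simp add: image_subset_iff)
  ultimately have "((\<lambda>t. f (u + t *\<^sub>R d)) has_derivative (\<lambda>t. D (t *\<^sub>R d))) (at 0)"
    by (rule has_derivative_in_compose)
  then have "((\<lambda>t. norm (f (u + t *\<^sub>R d) - f u - t *\<^sub>R D d) / norm t) \<longlongrightarrow> 0) (at 0)"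
    using has_derivative_linear[OF f] by (simp add: has_derivative_at linear_cmul)
  moreover have "norm ((1 / t) *\<^sub>R (f (u + t *\<^sub>R d) - f u) - D d)
      = norm (f (u + t *\<^sub>R d) - f u - t *\<^sub>R D d) / norm t" if "t \<noteq> 0" for t :: real
  proof -
    have "(1 / t) *\<^sub>R (f (u + t *\<^sub>R d) - f u) - D d = (1 / t) *\<^sub>R (f (u + t *\<^sub>R d) - f u - t *\<^sub>R D d)"
      using that by (simp add: scaleR_diff_right)
    then show ?thesis by (simp only: norm_scaleR) simp
  qed
  ultimately have "((\<lambda>t. norm ((1 / t) *\<^sub>R (f (u + t *\<^sub>R d) - f u) - D d)) \<longlongrightarrow> 0) (at 0)"
    by (elim Lim_transform_eventually) (auto simp: eventually_at_filter)
  then have "((\<lambda>t. (1 / t) *\<^sub>R (f (u + t *\<^sub>R d) - f u)) \<longlongrightarrow> D d) (at 0)"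
    by (simp add: tendsto_norm_zero_iff LIM_zero_iff)
  \<comment> \<open>This includes \<open>t = 0\<close>, where \<open>1 / 0 = 0\<close> makes the
    quotient the zero vector.\<close>
  moreover have "(1 / t) *\<^sub>R (f (u + t *\<^sub>R d) - f u) \<in> W" for t
    using V W in_V by (intro subspace_scale subspace_diff) auto
  ultimately show ?thesis
    using W(2) by (intro Lim_in_closed_set[where F = "at 0"]) auto
qed

section \<open>Structure of the finite element spaces\<close>

lemma subspace_P1_space: "subspace (P1_space \<Omega> (\<T> :: 'a::euclidean_space set set))"
  unfolding subspace_def
proof (intro conjI ballI allI)
  have "\<exists>a b. \<forall>x\<in>T. apply_bcontfun 0 x = a \<bullet> x + b" for T :: "'a set"
    by (rule exI[of _ 0], rule exI[of _ 0]) simp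
  then show "0 \<in> P1_space \<Omega> \<T>"
    unfolding P1_space_def by (intro CollectI conjI ballI) auto
next
  fix v w assume vw: "v \<in> P1_space \<Omega> \<T>" "w \<in> P1_space \<Omega> \<T>"
  show "v + w \<in> P1_space \<Omega> \<T>"
    unfolding P1_space_def
  proof (intro CollectI conjI ballI)
    fix T assume "T \<in> \<T>"
    obtain a b where v: "\<forall>x\<in>T. apply_bcontfun v x = a \<bullet> x + b"
      using vw(1) \<open>T \<in> \<T>\<close> unfolding P1_space_def by blast
    obtain a' b' where w: "\<forall>x\<in>T. apply_bcontfun w x = a' \<bullet> x + b'"
      using vw(2) \<open>T \<in> \<T>\<close> unfolding P1_space_def by blast
    have "\<forall>x\<in>T. apply_bcontfun (v + w) x = (a + a') \<bullet> x + (b + b')"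
      using v w by (simp add: inner_add_left)
    then show "\<exists>a b. \<forall>x\<in>T. apply_bcontfun (v + w) x = a \<bullet> x + b" by blast
  qed (use vw in \<open>auto simp: P1_space_def\<close>)
next
  fix c v assume v: "v \<in> P1_space \<Omega> \<T>"
  show "c *\<^sub>R v \<in> P1_space \<Omega> \<T>"
    unfolding P1_space_def
  proof (intro CollectI conjI ballI)
    fix T assume "T \<in> \<T>"
    with v obtain a b where "\<forall>x\<in>T. apply_bcontfun v x = a \<bullet> x + b"
      unfolding P1_space_def by blast
    then have "\<forall>x\<in>T. apply_bcontfun (c *\<^sub>R v) x = (c *\<^sub>R a) \<bullet> x + c * b"
      by (simp add: distrib_left)
    then show "\<exists>a b. \<forall>x\<in>T. apply_bcontfun (c *\<^sub>R v) x = a \<bullet> x + b" by blast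
  qed (use v in \<open>auto simp: P1_space_def\<close>)
qed

text \<open>An affine formula on a coarse simplex remains valid on every fine simplex inside
  it.\<close>

lemma P1_space_mono: "mesh_refines \<T>' \<T> \<Longrightarrow> P1_space \<Omega> \<T> \<subseteq> P1_space \<Omega> \<T>'"
  unfolding P1_space_def mesh_refines_def by (simp add: subset_iff) metis

text \<open>The mesh vertices serve as \<open>X\<close>: an affine function that vanishes at the
  vertices of a simplex vanishes on the whole simplex, and outside \<Omega> all functions of the
  space are zero.\<close>

lemma P1_space_determined_by_finite_set:
  assumes "mesh_of \<Omega> \<T>"
  obtains X where "finite X" "\<And>v. v \<in> P1_space \<Omega> \<T> \<Longrightarrow> (\<forall>x\<in>X. apply_bcontfun v x = 0) \<Longrightarrow> v = 0"
proof -
  have "\<forall>T\<in>\<T>. \<exists>C. finite C \<and> T = convex hull C"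
    using assms unfolding mesh_of_def simplex_def
    by (metis aff_independent_finite)
  then obtain N where N: "\<And>T. T \<in> \<T> \<Longrightarrow> finite (N T) \<and> T = convex hull N T"
    by metis
  show thesis
  proof (rule that)
    show "finite (\<Union>T\<in>\<T>. N T)"
      using N assms by (auto simp: mesh_of_def triangulation_def)
  next
    fix v assume v: "v \<in> P1_space \<Omega> \<T>" and zero: "\<forall>x\<in>(\<Union>T\<in>\<T>. N T). apply_bcontfun v x = 0"
    have "apply_bcontfun v x = 0" for x
    proof (cases "x \<in> \<Omega>")
      case True
      then have "x \<in> \<Union>\<T>"
        using assms closure_subset[of \<Omega>] by (auto simp: mesh_of_def)
      then obtain T where T: "T \<in> \<T>" "x \<in> T" by blast
      obtain a b where ab: "\<forall>x\<in>T. apply_bcontfun v x = a \<bullet> x + b"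
        using v T unfolding P1_space_def by blast
      have "N T \<subseteq> T" using N[OF T(1)] hull_subset by metis
      moreover have "apply_bcontfun v y = 0" if "y \<in> N T" for y
        using zero T that by blast
      ultimately have "N T \<subseteq> {y. a \<bullet> y = - b}"
        using ab by (force simp: eq_neg_iff_add_eq_0)
      \<comment> \<open>The zero set of the affine function is convex, so with the vertices it
        contains their convex hull.\<close>
      then have "T \<subseteq> {y. a \<bullet> y = - b}"
        using N[OF T(1)] hull_minimal[where S = convex] convex_hyperplane by metis
      then show ?thesis using ab T by auto
    qed (use v in \<open>simp add: P1_space_def\<close>)
    then show "v = 0" by (simp add: bcontfun_eqI)
  qed
qed

text \<open>The separating functionals are the point evaluations at the mesh vertices, which are
  bounded with constant 1 in the sup norm.\<close>

lemma closed_subspace_of_P1_space: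
  assumes "mesh_of \<Omega> \<T>" "subspace W" "W \<subseteq> P1_space \<Omega> \<T>"
  shows "closed W"
proof -
  obtain X where X: "finite X"
    "\<And>v. v \<in> P1_space \<Omega> \<T> \<Longrightarrow> (\<forall>x\<in>X. apply_bcontfun v x = 0) \<Longrightarrow> v = 0"
    using P1_space_determined_by_finite_set[OF assms(1)] by metis
  show ?thesis
  proof (rule closed_subspace_if_separated)
    show "finite ((\<lambda>x v. apply_bcontfun v x) ` X)" using X by simp
    fix v assume "v \<in> W" and "\<And>k. k \<in> (\<lambda>x v. apply_bcontfun v x) ` X \<Longrightarrow> k v = 0"
    then show "v = 0" using X(2) assms(3) by blast
  next
    fix k :: "('a \<Rightarrow>\<^sub>C real) \<Rightarrow> real"
    assume "k \<in> (\<lambda>x v. apply_bcontfun v x) ` X"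
    then obtain x where "k = (\<lambda>v. apply_bcontfun v x)" by blast
    moreover have "bounded_linear (\<lambda>v::'a \<Rightarrow>\<^sub>C real. apply_bcontfun v x)"
      by (rule bounded_linear_intro[where K = 1])
        (auto simp flip: real_norm_def intro: norm_bounded)
    ultimately show "bounded_linear k" by simp
  qed (rule assms)
qed

section \<open>Linear maps on subspaces and the fine space\<close>

lemma linear_on_subspace_diff:
  assumes "linear_on_subspace V f" "subspace V" "x \<in> V" "y \<in> V"
  shows "f (x - y) = f x - f y"
proof -
  have "f (x - y) = f (x + (-1) *\<^sub>R y)" by simp
  also have "\<dots> = f x + (-1) *\<^sub>R f y"
    using assms unfolding linear_on_subspace_def by (metis subspace_scale)
  finally show ?thesis by simp
qed

lemma subspace_fine_space:
  assumes "linear_on_subspace V P" "subspace V"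
  shows "subspace (fine_space V P)"
proof -
  have "P 0 = 0" using linear_on_subspace_diff[OF assms, of 0 0] assms(2) subspace_0 by auto
  then show ?thesis
    using assms unfolding subspace_def fine_space_def linear_on_subspace_def by auto
qed

text \<open>By idempotence \<open>P\<close> annihilates the difference. This yields the splitting of
  \<open>Vh\<close> into a coarse and a fine part.\<close>

lemma diff_projection_in_fine_space:
  assumes "stable_projection nrm C Vh VH P" "subspace Vh" "VH \<subseteq> Vh" "v \<in> Vh"
  shows "v - P v \<in> fine_space Vh P"
proof -
  have "P (v - P v) = P v - P (P v)"
    using assms by (intro linear_on_subspace_diff[of Vh]) (auto simp: stable_projection_def)
  then show ?thesis
    using assms by (auto simp: stable_projection_def fine_space_def intro!: subspace_diff)
qed

section \<open>Equivalence of the manifold equation and the fine-scale problem\<close>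

theorem proposition2p1:
  fixes \<Omega> :: "'a::euclidean_space set"
    and \<T>\<^sub>H \<T>\<^sub>h :: "'a set set"
    and \<sigma> \<rho> C :: real
    and V\<^sub>H V\<^sub>h V\<^sub>f :: "('a \<Rightarrow>\<^sub>C real) set"
    and a A :: "('a \<Rightarrow>\<^sub>C real) \<Rightarrow> ('a \<Rightarrow>\<^sub>C real) \<Rightarrow> real"
    and L :: "('a \<Rightarrow>\<^sub>C real) \<Rightarrow> real"
    and P\<^sub>H M\<^sub>h :: "('a \<Rightarrow>\<^sub>C real) \<Rightarrow> ('a \<Rightarrow>\<^sub>C real)"
  assumes "DIM('a) = 2 \<or> DIM('a) = 3"
    and "polyhedral_domain \<Omega>"
    and "mesh_of \<Omega> \<T>\<^sub>H" and "shape_regular \<sigma> \<T>\<^sub>H" and "quasi_uniform \<rho> \<T>\<^sub>H"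
    and "mesh_of \<Omega> \<T>\<^sub>h" and "shape_regular \<sigma> \<T>\<^sub>h" and "quasi_uniform \<rho> \<T>\<^sub>h"
    and "mesh_refines \<T>\<^sub>h \<T>\<^sub>H"
    and "V\<^sub>H = P1_space \<Omega> \<T>\<^sub>H" and "V\<^sub>h = P1_space \<Omega> \<T>\<^sub>h"
    and "inner_product_on V\<^sub>h a"
    and "\<And>u. u \<in> V\<^sub>h \<Longrightarrow> linear_on_subspace V\<^sub>h (A u)"
    and "linear_on_subspace V\<^sub>h L"
    and "stable_projection (energy_norm a) C V\<^sub>h V\<^sub>H P\<^sub>H"
    and "V\<^sub>f = fine_space V\<^sub>h P\<^sub>H"
    and "\<exists>!u. solves_fine_scale V\<^sub>h A L u"
    and "\<And>v\<^sub>H. v\<^sub>H \<in> V\<^sub>H \<Longrightarrow> \<exists>!v\<^sub>f. solves_correction V\<^sub>f A L v\<^sub>H v\<^sub>f"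
    and "M\<^sub>h = manifold_map V\<^sub>f A L"
  shows "(\<forall>u\<^sub>H\<in>V\<^sub>H. M\<^sub>h differentiable (at u\<^sub>H within V\<^sub>H) \<longrightarrow>
            solves_ideal_manifold V\<^sub>H V\<^sub>f A L u\<^sub>H \<longrightarrow> solves_fine_scale V\<^sub>h A L (M\<^sub>h u\<^sub>H)) \<and>
         (\<forall>u\<^sub>h. solves_fine_scale V\<^sub>h A L u\<^sub>h \<longrightarrow>
            M\<^sub>h differentiable (at (P\<^sub>H u\<^sub>h) within V\<^sub>H) \<longrightarrow>
            u\<^sub>h = M\<^sub>h (P\<^sub>H u\<^sub>h) \<and> solves_ideal_manifold V\<^sub>H V\<^sub>f A L (P\<^sub>H u\<^sub>h))"
proof -
  have Vh: "subspace V\<^sub>h" and VH: "subspace V\<^sub>H"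
    using assms(10,11) subspace_P1_space by auto
  have le: "V\<^sub>H \<subseteq> V\<^sub>h"
    using P1_space_mono assms(9-11) by blast
  have "linear_on_subspace V\<^sub>h P\<^sub>H" and P: "\<And>v. v \<in> V\<^sub>h \<Longrightarrow> P\<^sub>H v \<in> V\<^sub>H"
    using assms(15) by (auto simp: stable_projection_def)
  then have Vf: "subspace V\<^sub>f"
    using Vh assms(16) subspace_fine_space by blast
  have Vf_le: "V\<^sub>f \<subseteq> V\<^sub>h"
    using assms(16) by (auto simp: fine_space_def)
  have cl: "closed V\<^sub>f"
    using closed_subspace_of_P1_space assms(6,11) Vf Vf_le by blast
  have split: "v - P\<^sub>H v \<in> V\<^sub>f" if "v \<in> V\<^sub>h" for v
    using diff_projection_in_fine_space[OF assms(15) Vh le that] assms(16) by simp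
  \<comment> \<open>Unique solvability ensures that the \<open>THE\<close> in
    \<open>corrector\<close> denotes an actual solution.\<close>
  have corr: "solves_correction V\<^sub>f A L v (corrector V\<^sub>f A L v)" if "v \<in> V\<^sub>H" for v
    unfolding corrector_def using assms(18)[OF that] by (rule theI')
  have M_diff: "M\<^sub>h v - v \<in> V\<^sub>f" and M_eq: "\<And>w. w \<in> V\<^sub>f \<Longrightarrow> A (M\<^sub>h v) w = L w" if "v \<in> V\<^sub>H" for v
    using corr[OF that] by (auto simp: assms(19) manifold_map_def solves_correction_def)
  have M_in: "M\<^sub>h v \<in> V\<^sub>h" if "v \<in> V\<^sub>H" for v
    using subspace_add[OF Vh, of "M\<^sub>h v - v" v] M_diff[OF that] that Vf_le le by auto
  have DM: "frechet_derivative M\<^sub>h (at u within V\<^sub>H) d - d \<in> V\<^sub>f"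
    if "M\<^sub>h differentiable (at u within V\<^sub>H)" "u \<in> V\<^sub>H" "d \<in> V\<^sub>H" for u d
  proof -
    \<comment> \<open>Subtracting the identity leaves the corrector, whose values on
      \<open>V\<^sub>H\<close> lie in the closed space \<open>V\<^sub>f\<close>.\<close>
    have "((\<lambda>v. M\<^sub>h v - v) has_derivative (\<lambda>d. frechet_derivative M\<^sub>h (at u within V\<^sub>H) d - d))
        (at u within V\<^sub>H)"
      using that(1) by (intro has_derivative_diff has_derivative_ident)
        (simp add: frechet_derivative_works)
    then show ?thesis
      using has_derivative_in_closed_subspace[OF _ VH that(2,3) Vf cl] M_diff by blast
  qed
  show ?thesis
  proof (intro conjI ballI allI impI)
    fix u assume u: "u \<in> V\<^sub>H" and dif: "M\<^sub>h differentiable (at u within V\<^sub>H)"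
      and sol: "solves_ideal_manifold V\<^sub>H V\<^sub>f A L u"
    show "solves_fine_scale V\<^sub>h A L (M\<^sub>h u)"
      unfolding solves_fine_scale_def
    proof (intro conjI ballI)
      fix v assume v: "v \<in> V\<^sub>h"
      \<comment> \<open>The tangent vector with the same coarse part as \<open>v\<close>. Hence
        \<open>v - ?d\<close> is a fine test function, covered by the correction equation, while
        \<open>?d\<close> is covered by the manifold equation.\<close>
      let ?d = "frechet_derivative M\<^sub>h (at u within V\<^sub>H) (P\<^sub>H v)"
      have "(v - P\<^sub>H v) - (?d - P\<^sub>H v) \<in> V\<^sub>f"
        using split[OF v] DM[OF dif u P[OF v]] Vf subspace_diff by blast
      then have w: "v - ?d \<in> V\<^sub>f" by simp
      have d: "?d \<in> V\<^sub>h"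
        using subspace_diff[OF Vh v, of "v - ?d"] w Vf_le by auto
      have "A (M\<^sub>h u) ?d = L ?d"
        using sol P[OF v] by (simp add: solves_ideal_manifold_def Let_def assms(19))
      \<comment> \<open>The first argument stays fixed at \<open>M\<^sub>h u\<close>, so linearity
        in the second argument suffices to combine the two equations.\<close>
      moreover have "A (M\<^sub>h u) (v - ?d) = A (M\<^sub>h u) v - A (M\<^sub>h u) ?d" "L (v - ?d) = L v - L ?d"
        using linear_on_subspace_diff Vh v d assms(13,14) M_in[OF u] by blast+
      ultimately show "A (M\<^sub>h u) v = L v"
        using M_eq[OF u w] by simp
    qed (rule M_in[OF u])
  next
    fix u assume sol: "solves_fine_scale V\<^sub>h A L u"
    then have u: "u \<in> V\<^sub>h" and eq: "\<And>v. v \<in> V\<^sub>h \<Longrightarrow> A u v = L v"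
      by (auto simp: solves_fine_scale_def)
    \<comment> \<open>The fine part of \<open>u\<close> added to \<open>P\<^sub>H u\<close> gives
      back \<open>u\<close>, and fine test functions are among those of the fine-scale problem.
      Uniqueness then identifies it with the corrector.\<close>
    have "solves_correction V\<^sub>f A L (P\<^sub>H u) (u - P\<^sub>H u)"
      using split[OF u] eq Vf_le by (auto simp: solves_correction_def)
    then have "corrector V\<^sub>f A L (P\<^sub>H u) = u - P\<^sub>H u"
      using assms(18)[OF P[OF u]] corr[OF P[OF u]] by blast
    then show M: "u = M\<^sub>h (P\<^sub>H u)" by (simp add: assms(19) manifold_map_def)
    assume dif: "M\<^sub>h differentiable (at (P\<^sub>H u) within V\<^sub>H)"
    \<comment> \<open>Tangent vectors are thereby admissible test functions in the fine-scale
      problem, and the manifold equation is a special case of it.\<close>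
    have "frechet_derivative M\<^sub>h (at (P\<^sub>H u) within V\<^sub>H) d \<in> V\<^sub>h" if "d \<in> V\<^sub>H" for d
      using subspace_add[OF Vh, of "frechet_derivative M\<^sub>h (at (P\<^sub>H u) within V\<^sub>H) d - d" d]
        DM[OF dif P[OF u] that] that Vf_le le by auto
    then show "solves_ideal_manifold V\<^sub>H V\<^sub>f A L (P\<^sub>H u)"
      using eq M P[OF u] by (simp add: solves_ideal_manifold_def Let_def flip: assms(19))
  qed
qed

end
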